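(* Let $k\ge 1$ be an integer and let $\nu\ge 2k+2$ be an even integer. Then the minimum number of edges of a $k$-extendable bipartite graph on $\nu$ vertices is exactly $\nu(k+1)/2$.
   Context: All graphs are finite, connected and simple. A connected graph $G$ on $\nu$ vertices is $k$-extendable, where $k$ is an integer with $0\le k\le (\nu-2)/2$, if $G$ contains a matching of size $k$ and every matching of size $k$ in $G$ is contained in a perfect matching of $G$. *)

theory Defs
  imports Complex_Main
begin

text \<open>A simple graph is given by its vertex set and its edge set, where an edge is the
  two-element set of its endpoints.\<close>

type_synonym 'a edge = "'a set"

definition fin_simple_graph :: "'a set \<Rightarrow> 'a edge set \<Rightarrow> bool" where
  "fin_simple_graph V E \<longleftrightarrow> finite V \<and> (\<forall>e\<in>E. e \<subseteq> V \<and> card e = 2)"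

definition connected_graph :: "'a set \<Rightarrow> 'a edge set \<Rightarrow> bool" where
  "connected_graph V E \<longleftrightarrow>
     fin_simple_graph V E \<and> V \<noteq> {} \<and> (\<forall>u\<in>V. \<forall>v\<in>V. (u, v) \<in> {(x, y). {x, y} \<in> E}\<^sup>*)"

definition bipartite_graph :: "'a set \<Rightarrow> 'a edge set \<Rightarrow> bool" where
  "bipartite_graph V E \<longleftrightarrow>
     fin_simple_graph V E \<and>
     (\<exists>A B. A \<union> B = V \<and> A \<inter> B = {} \<and> (\<forall>e\<in>E. \<exists>a\<in>A. \<exists>b\<in>B. e = {a, b}))"

definition graph_matching :: "'a edge set \<Rightarrow> 'a edge set \<Rightarrow> bool" where
  "graph_matching E M \<longleftrightarrow> M \<subseteq> E \<and> (\<forall>e\<in>M. \<forall>f\<in>M. e \<noteq> f \<longrightarrow> e \<inter> f = {})"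

definition perfect_matching :: "'a set \<Rightarrow> 'a edge set \<Rightarrow> 'a edge set \<Rightarrow> bool" where
  "perfect_matching V E M \<longleftrightarrow> graph_matching E M \<and> \<Union>M = V"

text \<open>The condition \<open>2 * k + 2 \<le> card V\<close> is \<open>k \<le> (\<nu> - 2) / 2\<close> without truncated subtraction.\<close>

definition extendable :: "nat \<Rightarrow> 'a set \<Rightarrow> 'a edge set \<Rightarrow> bool" where
  "extendable k V E \<longleftrightarrow>
     connected_graph V E \<and> 2 * k + 2 \<le> card V \<and>
     (\<exists>M. graph_matching E M \<and> card M = k) \<and>
     (\<forall>M. graph_matching E M \<and> card M = k \<longrightarrow> (\<exists>P. perfect_matching V E P \<and> M \<subseteq> P))"

end

theory Submission
  imports Defs
begin

text \<open>By connectedness every nonempty proper subset \<open>S\<close> of one side of an extendable bipartite graph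
  has more than \<open>card S\<close> neighbours, so by Hall's theorem deleting any vertex \<open>v\<close> on that side and
  any \<open>z\<close> on the other leaves a perfectly matchable graph. Taking \<open>z\<close> not adjacent to \<open>v\<close> shows that
  \<open>v\<close> has degree at least \<open>k + 1\<close>; summing over one side gives the bound. It is attained by the
  circulant joining \<open>i\<close> to \<open>i, \<dots>, i + k\<close> modulo \<open>n\<close>: there every \<open>S\<close> has at least
  \<open>min n (card S + k)\<close> neighbours, so Hall's condition survives deleting a matching of size \<open>k\<close>.\<close>

section \<open>Hall's marriage theorem\<close>

text \<open>The argument is that of Halmos and Vaughan: split at a tight proper subset if there is one,
  and otherwise match one vertex arbitrarily.\<close>

lemma hall:
  assumes "finite A" and "finite (R `` A)" and "\<And>S. S \<subseteq> A \<Longrightarrow> card S \<le> card (R `` S)"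
  shows "\<exists>g. inj_on g A \<and> (\<forall>a\<in>A. (a, g a) \<in> R)"
  using assms
proof (induction "card A" arbitrary: A R rule: less_induct)
  case less
  note fin = less.prems(1,2) and H = less.prems(3)
  have finS: "finite S" "finite (R `` S)" if "S \<subseteq> A" for S
    using fin that by (auto intro: finite_subset Image_mono)
  show ?case
  proof (cases "\<exists>S. S \<subset> A \<and> S \<noteq> {} \<and> card (R `` S) = card S")
    case True
    then obtain S where S: "S \<subset> A" "S \<noteq> {}" "card (R `` S) = card S" by blast
    \<comment> \<open>Vertices outside \<open>S\<close> may only use partners not adjacent to
      \<open>S\<close>, so the two partial matchings cannot collide. Tightness of \<open>S\<close>
      is what carries Hall's condition over to \<open>Q\<close>.\<close>
    define Q where "Q = {(a, b) \<in> R. b \<notin> R `` S}"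
    have cS: "card S < card A" using S fin(1) by (simp add: psubset_card_mono)
    have cD: "card (A - S) < card A"
      using S fin(1) by (intro psubset_card_mono) auto
    have "\<exists>g. inj_on g S \<and> (\<forall>a\<in>S. (a, g a) \<in> R)"
      using less.hyps[OF cS, of R] finS[of S] H S by (meson psubset_imp_subset subset_trans)
    then obtain g1 where g1: "inj_on g1 S" "\<And>a. a \<in> S \<Longrightarrow> (a, g1 a) \<in> R" by blast
    have "card T \<le> card (Q `` T)" if T: "T \<subseteq> A - S" for T
    proof -
      have TS: "T \<union> S \<subseteq> A" "T \<inter> S = {}" using T S by auto
      have "card T + card S = card (T \<union> S)"
        using TS finS[of T] finS[of S] by (simp add: card_Un_disjoint)
      also have "\<dots> \<le> card (R `` (T \<union> S))" using TS H by blast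
      also have "R `` (T \<union> S) = Q `` T \<union> R `` S" by (auto simp: Q_def)
      also have "card \<dots> \<le> card (Q `` T) + card (R `` S)" by (rule card_Un_le)
      finally show ?thesis using S(3) by simp
    qed
    moreover have "finite (Q `` (A - S))"
      by (rule finite_subset[OF _ fin(2)]) (auto simp: Q_def)
    ultimately have "\<exists>g. inj_on g (A - S) \<and> (\<forall>a\<in>A - S. (a, g a) \<in> Q)"
      using less.hyps[OF cD, of Q] fin(1) by blast
    then obtain g2 where g2: "inj_on g2 (A - S)" "\<And>a. a \<in> A - S \<Longrightarrow> (a, g2 a) \<in> Q" by blast
    define g where "g = (\<lambda>a. if a \<in> S then g1 a else g2 a)"
    have ne: "g1 a \<noteq> g2 b" if "a \<in> S" "b \<in> A - S" for a b
      using g1(2)[OF that(1)] g2(2)[OF that(2)] that(1) by (auto simp: Q_def)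
    have "inj_on g A"
      using g1(1) g2(1) ne unfolding inj_on_def g_def by (metis DiffI)
    moreover have "(a, g a) \<in> R" if "a \<in> A" for a
      using that g1(2) g2(2) by (auto simp: g_def Q_def)
    ultimately show ?thesis by blast
  next
    case False
    then have strict: "card S < card (R `` S)" if "S \<subset> A" "S \<noteq> {}" for S
      using H[of S] that by (metis le_neq_implies_less psubset_imp_subset)
    show ?thesis
    proof (cases "A = {}")
      case True
      then show ?thesis by auto
    next
      case nonempty: False
      then obtain a where a: "a \<in> A" by blast
      have "R `` {a} \<noteq> {}" using H[of "{a}"] a by (metis card.empty card_1_singleton_iff
        empty_subsetI insert_subset not_one_le_zero One_nat_def)
      then obtain b where b: "(a, b) \<in> R" by blast
      \<comment> \<open>Giving up \<open>b\<close> costs each set at most one neighbour, and with no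
        tight proper subset there is one to spare.\<close>
      define Q where "Q = {(x, y) \<in> R. y \<noteq> b}"
      have cD: "card (A - {a}) < card A" using a fin(1) by (rule card_Diff1_less[rotated])
      have "card T \<le> card (Q `` T)" if T: "T \<subseteq> A - {a}" for T
      proof (cases "T = {}")
        case False
        have QT: "Q `` T = R `` T - {b}" by (auto simp: Q_def)
        have "card T < card (R `` T)" using strict[of T] T a False by blast
        then show ?thesis unfolding QT
          using finS(2)[of T] T card_Diff1_le[of "R `` T" b] by (cases "b \<in> R `` T") auto
      qed auto
      moreover have "finite (Q `` (A - {a}))"
        by (rule finite_subset[OF _ fin(2)]) (auto simp: Q_def)
      ultimately have "\<exists>g. inj_on g (A - {a}) \<and> (\<forall>x\<in>A - {a}. (x, g x) \<in> Q)"
        using less.hyps[OF cD, of Q] fin(1) by blast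
      then obtain g where g: "inj_on g (A - {a})" "\<And>x. x \<in> A - {a} \<Longrightarrow> (x, g x) \<in> Q" by blast
      have "inj_on (g(a := b)) A"
        using g unfolding inj_on_def Q_def by (auto simp: fun_upd_def)
      moreover have "(x, (g(a := b)) x) \<in> R" if "x \<in> A" for x
        using that g(2) b by (auto simp: Q_def)
      ultimately show ?thesis by blast
    qed
  qed
qed

section \<open>Bipartite graphs as relations between two sides\<close>

text \<open>Orienting every edge from \<open>A\<close> to \<open>B\<close> turns neighbourhoods into
  relational images, the form in which Hall's theorem is stated. Disjointness of the sides lets the
  ordered pair be recovered from the unordered edge.\<close>

locale bigraph =
  fixes A B :: "'a set" and R :: "('a \<times> 'a) set"
  assumes finite_sides: "finite A" "finite B"
    and disjoint_sides: "A \<inter> B = {}"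
    and sides: "R \<subseteq> A \<times> B"
begin

definition edges :: "'a edge set" where
  "edges = (\<lambda>(a, b). {a, b}) ` R"

text \<open>A matching is represented by the set \<open>X \<subseteq> A\<close> of its endpoints in \<open>A\<close> and the function
  \<open>g\<close> sending each of them to its partner; \<open>g\<close> is irrelevant outside \<open>X\<close>.\<close>

definition saturates :: "'a set \<Rightarrow> ('a \<Rightarrow> 'a) \<Rightarrow> bool" where
  "saturates X g \<longleftrightarrow> X \<subseteq> A \<and> inj_on g X \<and> (\<forall>x\<in>X. (x, g x) \<in> R)"

definition matching_of :: "'a set \<Rightarrow> ('a \<Rightarrow> 'a) \<Rightarrow> 'a edge set" where
  "matching_of X g = (\<lambda>x. {x, g x}) ` X"

lemma finite_R: "finite R"
  using finite_sides sides by (meson finite_SigmaI finite_subset)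

lemma edge_inD: "(a, b) \<in> R \<Longrightarrow> a \<in> A \<and> b \<in> B \<and> a \<notin> B \<and> b \<notin> A"
  using sides disjoint_sides by blast

lemma edge_eq_iff:
  assumes "(a, b) \<in> R" "(c, d) \<in> R"
  shows "{a, b} = {c, d} \<longleftrightarrow> a = c \<and> b = d"
  using edge_inD[OF assms(1)] edge_inD[OF assms(2)] by (auto simp: doubleton_eq_iff)

lemma edge_iff: "a \<in> A \<Longrightarrow> {a, b} \<in> edges \<longleftrightarrow> (a, b) \<in> R"
  unfolding edges_def using edge_inD by (auto simp: doubleton_eq_iff image_iff)

lemma card_edges: "card edges = card R"
  unfolding edges_def by (rule card_image) (auto simp: inj_on_def edge_eq_iff)

lemma fin_simple: "fin_simple_graph (A \<union> B) edges"
proof -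
  have "card {a, b} = 2" if "(a, b) \<in> R" for a b
    using edge_inD[OF that] by (metis card_2_iff)
  then show ?thesis
    unfolding fin_simple_graph_def edges_def using finite_sides edge_inD by auto
qed

lemma bipartite: "bipartite_graph (A \<union> B) edges"
  unfolding bipartite_graph_def
proof (intro conjI)
  have "\<forall>e\<in>edges. \<exists>a\<in>A. \<exists>b\<in>B. e = {a, b}" unfolding edges_def using edge_inD by auto
  then show "\<exists>A' B'. A' \<union> B' = A \<union> B \<and> A' \<inter> B' = {} \<and> (\<forall>e\<in>edges. \<exists>a\<in>A'. \<exists>b\<in>B'. e = {a, b})"
    using disjoint_sides by blast
qed (rule fin_simple)

lemma matching_of_eqD:
  assumes "saturates X g" "saturates Y h" "matching_of X g \<subseteq> matching_of Y h" "x \<in> X"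
  shows "x \<in> Y \<and> h x = g x"
proof -
  obtain y where "y \<in> Y" "{x, g x} = {y, h y}"
    using assms(3,4) unfolding matching_of_def by blast
  moreover have "(x, g x) \<in> R" "(y, h y) \<in> R"
    using assms \<open>y \<in> Y\<close> unfolding saturates_def by auto
  ultimately show ?thesis using edge_eq_iff by metis
qed

lemma card_matching_of:
  assumes "saturates X g" shows "card (matching_of X g) = card X"
  unfolding matching_of_def
  by (rule card_image) (use assms edge_eq_iff in \<open>auto simp: inj_on_def saturates_def\<close>)

text \<open>Edges of a matching that share an endpoint coincide, so each matched vertex of
  \<open>A\<close> has one partner, and different vertices have different partners.\<close>

lemma matching_iff:
  "graph_matching edges M \<longleftrightarrow> (\<exists>X g. saturates X g \<and> M = matching_of X g)"
proof
  assume M: "graph_matching edges M"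
  then have same: "e = f" if "e \<in> M" "f \<in> M" "e \<inter> f \<noteq> {}" for e f
    using that unfolding graph_matching_def by blast
  define X where "X = {a \<in> A. \<exists>b. {a, b} \<in> M}"
  define g where "g a = (SOME b. {a, b} \<in> M)" for a
  have g: "{a, g a} \<in> M" if "a \<in> X" for a
    using that unfolding X_def g_def by (auto intro: someI)
  have gR: "(a, g a) \<in> R" if "a \<in> X" for a
    using g[OF that] that edge_iff M unfolding graph_matching_def X_def by blast
  have "inj_on g X"
  proof
    fix x y assume xy: "x \<in> X" "y \<in> X" "g x = g y"
    then have "{x, g x} \<inter> {y, g y} \<noteq> {}" by auto
    then have "{x, g x} = {y, g y}"
      by (rule same[OF g[OF xy(1)] g[OF xy(2)]])
    then show "x = y" using edge_eq_iff[OF gR gR] xy by blast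
  qed
  moreover have "M = matching_of X g"
  proof
    show "matching_of X g \<subseteq> M" unfolding matching_of_def using g by auto
    show "M \<subseteq> matching_of X g"
    proof
      fix e assume e: "e \<in> M"
      then obtain a b where ab: "e = {a, b}" "(a, b) \<in> R"
        using M unfolding graph_matching_def edges_def by auto
      then have a: "a \<in> X" using e edge_inD unfolding X_def by auto
      have "e \<inter> {a, g a} \<noteq> {}" using ab by auto
      then have "e = {a, g a}" by (rule same[OF e g[OF a]])
      then show "e \<in> matching_of X g" using a unfolding matching_of_def by blast
    qed
  qed
  moreover have "X \<subseteq> A" by (auto simp: X_def)
  ultimately show "\<exists>X g. saturates X g \<and> M = matching_of X g"
    using gR unfolding saturates_def by blast
next
  assume "\<exists>X g. saturates X g \<and> M = matching_of X g"
  then obtain X g where Xg: "saturates X g" "M = matching_of X g" by blast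
  show "graph_matching edges M"
    unfolding graph_matching_def
  proof (intro conjI ballI impI)
    show "M \<subseteq> edges"
      using Xg unfolding matching_of_def saturates_def edges_def by auto
  next
    fix e f assume ef: "e \<in> M" "f \<in> M" "e \<noteq> f"
    then obtain x y where xy: "x \<in> X" "y \<in> X" "e = {x, g x}" "f = {y, g y}"
      unfolding Xg(2) matching_of_def by blast
    then have "x \<noteq> y" using ef(3) by auto
    moreover have "(x, g x) \<in> R" "(y, g y) \<in> R" "inj_on g X"
      using Xg(1) xy unfolding saturates_def by blast+
    ultimately show "e \<inter> f = {}"
      using edge_inD[of x "g x"] edge_inD[of y "g y"] xy inj_onD[of g X x y] by blast
  qed
qed

text \<open>Since \<open>A\<close> and \<open>B\<close> are disjoint, covering all vertices splits
  into \<open>X = A\<close> and surjectivity onto \<open>B\<close>.\<close>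

lemma perfect_iff:
  "perfect_matching (A \<union> B) edges M \<longleftrightarrow> (\<exists>g. saturates A g \<and> g ` A = B \<and> M = matching_of A g)"
proof
  assume P: "perfect_matching (A \<union> B) edges M"
  then obtain X g where Xg: "saturates X g" "M = matching_of X g"
    unfolding perfect_matching_def matching_iff by blast
  have "X \<union> g ` X = A \<union> B"
    using P unfolding Xg(2) perfect_matching_def matching_of_def by auto
  moreover have "X \<subseteq> A" "g ` X \<subseteq> B" using Xg(1) edge_inD unfolding saturates_def by auto
  ultimately have "X = A" "g ` X = B" using disjoint_sides by blast+
  then show "\<exists>g. saturates A g \<and> g ` A = B \<and> M = matching_of A g" using Xg by blast
next
  assume "\<exists>g. saturates A g \<and> g ` A = B \<and> M = matching_of A g"
  then show "perfect_matching (A \<union> B) edges M"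
    unfolding perfect_matching_def matching_iff by (auto simp: matching_of_def)
qed

text \<open>Containment of one matching in another amounts to agreement of their partner functions,
  because the endpoint in \<open>A\<close> identifies an edge of a matching. All later arguments
  work with functions instead of edge sets.\<close>

lemma extendable_iff:
  "extendable k (A \<union> B) edges \<longleftrightarrow>
     connected_graph (A \<union> B) edges \<and> 2 * k + 2 \<le> card (A \<union> B) \<and>
     (\<exists>X g. saturates X g \<and> card X = k) \<and>
     (\<forall>X g. saturates X g \<and> card X = k \<longrightarrow>
        (\<exists>h. saturates A h \<and> h ` A = B \<and> (\<forall>x\<in>X. h x = g x)))"
proof -
  have sub: "matching_of X g \<subseteq> matching_of A h \<longleftrightarrow> (\<forall>x\<in>X. h x = g x)"
    if "saturates X g" "saturates A h" for X g h
  proof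
    assume "matching_of X g \<subseteq> matching_of A h"
    then show "\<forall>x\<in>X. h x = g x" using matching_of_eqD that by blast
  next
    assume "\<forall>x\<in>X. h x = g x"
    moreover have "X \<subseteq> A" using that saturates_def by blast
    ultimately show "matching_of X g \<subseteq> matching_of A h"
      unfolding matching_of_def by (auto simp: image_iff)
  qed
  have 1: "(\<exists>M. graph_matching edges M \<and> card M = k) \<longleftrightarrow> (\<exists>X g. saturates X g \<and> card X = k)"
    using matching_iff card_matching_of by metis
  have 2: "(\<forall>M. graph_matching edges M \<and> card M = k \<longrightarrow>
        (\<exists>P. perfect_matching (A \<union> B) edges P \<and> M \<subseteq> P)) \<longleftrightarrow>
     (\<forall>X g. saturates X g \<and> card X = k \<longrightarrow>
        (\<exists>P. perfect_matching (A \<union> B) edges P \<and> matching_of X g \<subseteq> P))"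
    using matching_iff card_matching_of by metis
  have 3: "(\<exists>P. perfect_matching (A \<union> B) edges P \<and> matching_of X g \<subseteq> P) \<longleftrightarrow>
        (\<exists>h. saturates A h \<and> h ` A = B \<and> (\<forall>x\<in>X. h x = g x))" if "saturates X g" for X g
    unfolding perfect_iff using sub[OF that] by blast
  show ?thesis unfolding extendable_def 1 2 using 3 by auto
qed

section \<open>Extending matchings by Hall's theorem\<close>

text \<open>Hall's theorem for the relation restricted to targets in \<open>Y\<close>; this form
  serves to delete vertices on both sides at once.\<close>

lemma hall_into:
  assumes "X \<subseteq> A" and "\<And>S. S \<subseteq> X \<Longrightarrow> card S \<le> card (R `` S \<inter> Y)"
  shows "\<exists>g. saturates X g \<and> g ` X \<subseteq> Y"
proof -
  define Q where "Q = R \<inter> UNIV \<times> Y"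
  have Q: "Q `` S = R `` S \<inter> Y" for S by (auto simp: Q_def)
  have "finite X" using assms(1) finite_sides(1) finite_subset by blast
  moreover have "finite (Q `` X)" using finite_R by (auto simp: Q_def intro: finite_Image)
  ultimately obtain g where "inj_on g X" "\<forall>x\<in>X. (x, g x) \<in> Q"
    using hall[of X Q] assms(2) Q by auto
  then show ?thesis using assms(1) by (auto simp: saturates_def Q_def)
qed

lemma saturates_image: "saturates X g \<Longrightarrow> g ` X \<subseteq> B"
  using edge_inD by (auto simp: saturates_def)

lemma finite_image_R: "finite (R `` S)"
  using finite_R by (auto intro: finite_Image)

text \<open>Deleting the \<open>k\<close> partners in the image of \<open>X\<close> removes at most
  \<open>k\<close> neighbours of a set \<open>S\<close>. If \<open>S\<close> avoids
  \<open>X\<close>, then \<open>card S + k\<close> does not exceed \<open>card A\<close>, so the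
  minimum in the hypothesis is \<open>card S + k\<close> and Hall's condition survives.\<close>

lemma saturates_extension:
  assumes expand: "\<And>S. \<lbrakk>S \<subseteq> A; S \<noteq> {}\<rbrakk> \<Longrightarrow> min (card A) (card S + k) \<le> card (R `` S)"
    and AB: "card A = card B" and g: "saturates X g" "card X = k"
  shows "\<exists>h. saturates A h \<and> h ` A = B \<and> (\<forall>x\<in>X. h x = g x)"
proof -
  have X: "X \<subseteq> A" "inj_on g X" using g(1) by (auto simp: saturates_def)
  then have fX: "finite X" using finite_sides(1) finite_subset by blast
  have gX: "card (g ` X) = k" using X(2) g(2) by (simp add: card_image)
  have "\<exists>f. saturates (A - X) f \<and> f ` (A - X) \<subseteq> - g ` X"
  proof (rule hall_into)
    fix S assume S: "S \<subseteq> A - X"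
    show "card S \<le> card (R `` S \<inter> - g ` X)"
    proof (cases "S = {}")
      case False
      have "card S + k = card (S \<union> X)"
        using S fX finite_sides(1) g(2) finite_subset[of S A] by (subst card_Un_disjoint) auto
      also have "\<dots> \<le> card A"
        using S X(1) finite_sides(1) by (intro card_mono) auto
      finally have "card S + k \<le> card (R `` S)" using expand[of S] S False by auto
      also have "\<dots> - card (g ` X) \<le> card (R `` S - g ` X)"
        by (rule diff_card_le_card_Diff) (use fX in auto)
      finally show ?thesis unfolding Diff_eq gX by simp
    qed auto
  qed auto
  then obtain f where f: "saturates (A - X) f" "f ` (A - X) \<subseteq> - g ` X" by blast
  define h where "h = (\<lambda>x. if x \<in> X then g x else f x)"
  have "inj_on h A"
  proof (rule inj_onI)
    fix x y assume xy: "x \<in> A" "y \<in> A" "h x = h y"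
    then have "x \<in> X \<longleftrightarrow> y \<in> X" using f(2) by (auto simp: h_def split: if_splits)
    then show "x = y"
      using xy X(2) f(1) by (auto simp: h_def saturates_def inj_on_def split: if_splits)
  qed
  moreover have "(x, h x) \<in> R" if "x \<in> A" for x
    using that f(1) g(1) by (auto simp: h_def saturates_def)
  ultimately have h: "saturates A h" by (auto simp: saturates_def)
  moreover have "h ` A = B"
    by (rule card_subset_eq)
      (use finite_sides AB saturates_image[OF h] \<open>inj_on h A\<close> in \<open>auto simp: card_image\<close>)
  moreover have "\<forall>x\<in>X. h x = g x" by (simp add: h_def)
  ultimately show ?thesis by blast
qed

section \<open>The lower bound from extendability\<close>

lemma extendableD:
  assumes "extendable k (A \<union> B) edges"
  shows "connected_graph (A \<union> B) edges" and "2 * k + 2 \<le> card (A \<union> B)"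
    and "\<exists>X g. saturates X g \<and> card X = k"
    and "\<And>X g. \<lbrakk>saturates X g; card X = k\<rbrakk> \<Longrightarrow>
      \<exists>h. saturates A h \<and> h ` A = B \<and> (\<forall>x\<in>X. h x = g x)"
  using iffD1[OF extendable_iff assms] by simp_all

text \<open>Some matching of size \<open>k\<close> exists and extends to a perfect matching, which
  is a bijection between the sides.\<close>

lemma extendable_sides:
  assumes "extendable k (A \<union> B) edges"
  obtains f where "saturates A f" "f ` A = B" "card A = card B" "k + 1 \<le> card A"
    "card (A \<union> B) = 2 * card A"
proof -
  obtain X g where "saturates X g" "card X = k" using extendableD(3)[OF assms] by blast
  then obtain f where f: "saturates A f" "f ` A = B" using extendableD(4)[OF assms] by blast
  then have eq: "card A = card B" by (metis card_image saturates_def)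
  then have "card (A \<union> B) = 2 * card A"
    using finite_sides disjoint_sides by (simp add: card_Un_disjoint)
  moreover have "2 * k + 2 \<le> card (A \<union> B)" by (rule extendableD(2)[OF assms])
  ultimately show ?thesis using that f eq by simp
qed

text \<open>If \<open>S\<close> had only \<open>card S\<close> neighbours, then connectedness would yield an edge from outside
  \<open>S\<close> to a neighbour of \<open>S\<close>, and no perfect matching could contain that edge.\<close>

lemma extendable_expansion:
  assumes ext: "extendable k (A \<union> B) edges" and k: "k \<ge> 1" and S: "S \<subset> A" "S \<noteq> {}"
  shows "card S < card (R `` S)"
proof (rule ccontr)
  assume less: "\<not> card S < card (R `` S)"
  obtain f where f: "saturates A f" "f ` A = B" and n: "k + 1 \<le> card A"
    using extendable_sides[OF ext] by blast
  have injf: "inj_on f A" and fR: "\<And>x. x \<in> A \<Longrightarrow> (x, f x) \<in> R" using f by (auto simp: saturates_def)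
  have cS: "card (f ` S) = card S" using injf S(1) by (meson card_image inj_on_subset psubset_imp_subset)
  \<comment> \<open>The partners of \<open>S\<close> under \<open>f\<close> are neighbours of
    \<open>S\<close> and already as numerous as all of them.\<close>
  have fS: "f ` S = R `` S"
    by (rule card_seteq) (use S fR less cS finite_image_R in auto)
  obtain s t where st: "s \<in> S" "t \<in> A - S" using S by blast
  \<comment> \<open>A path from \<open>s\<close> to \<open>t\<close> has to leave the union of
    \<open>S\<close> and its neighbours. The edge where it leaves cannot start in \<open>S\<close>,
    so it starts at a neighbour \<open>x\<close> of \<open>S\<close>.\<close>
  have "\<exists>x y. {x, y} \<in> edges \<and> x \<in> S \<union> f ` S \<and> y \<notin> S \<union> f ` S"
  proof (rule ccontr)
    assume no: "\<not> ?thesis"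
    have "(s, t) \<in> {(x, y). {x, y} \<in> edges}\<^sup>*"
      using extendableD(1)[OF ext] st S unfolding connected_graph_def by blast
    then have "t \<in> S \<union> f ` S"
      by (induction rule: rtrancl_induct) (use no st in blast)+
    then show False using st fS edge_inD by blast
  qed
  then obtain x y where xy: "{x, y} \<in> edges" "x \<in> S \<union> f ` S" "y \<notin> S \<union> f ` S" by blast
  have "x \<notin> S"
    using xy edge_iff[of x y] fS S(1) by blast
  then obtain s' where s': "s' \<in> S" "x = f s'" using xy(2) by blast
  have yx: "(y, x) \<in> R"
  proof -
    have "x \<notin> A" using s' S(1) fR edge_inD by blast
    obtain a b where ab: "{x, y} = {a, b}" "(a, b) \<in> R" using xy(1) unfolding edges_def by auto
    then have "a \<in> A" using edge_inD by blast
    then have "a = y" "b = x" using ab(1) \<open>x \<notin> A\<close> by (auto simp: doubleton_eq_iff)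
    then show ?thesis using ab(2) by simp
  qed
  have yA: "y \<in> A" using yx edge_inD by blast
  \<comment> \<open>The edge from \<open>y\<close> to \<open>x\<close> is padded to a matching of
    size \<open>k\<close> with edges of \<open>f\<close>. Avoiding \<open>s'\<close>, the partner of
    \<open>x\<close> under \<open>f\<close>, keeps the function injective.\<close>
  have "k - 1 \<le> card (A - {y, s'})"
    using diff_card_le_card_Diff[of "{y, s'}" A] card_2_iff[of "{y, s'}"] n xy(3) s' by auto
  then obtain Y where Y: "Y \<subseteq> A - {y, s'}" "card Y = k - 1" "finite Y"
    by (meson obtain_subset_with_card_n)
  have "saturates (insert y Y) (f(y := x))"
    unfolding saturates_def
  proof (intro conjI ballI)
    have "f z \<noteq> x" if "z \<in> Y" for z
      using that Y(1) s' S(1) inj_onD[OF injf, of z s'] by blast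
    then show "inj_on (f(y := x)) (insert y Y)"
      using inj_on_subset[OF injf, of Y] Y(1) by (auto simp: inj_on_def)
  qed (use yA Y yx fR in auto)
  moreover have "card (insert y Y) = k" using Y k by (subst card_insert_disjoint) auto
  ultimately obtain h where h: "saturates A h" "\<forall>z\<in>insert y Y. h z = (f(y := x)) z"
    using extendableD(4)[OF ext] by blast
  have "inj_on h A" and hR: "\<And>x. x \<in> A \<Longrightarrow> (x, h x) \<in> R" using h(1) by (auto simp: saturates_def)
  \<comment> \<open>The perfect matching \<open>h\<close> also uses up all neighbours of
    \<open>S\<close> on \<open>S\<close>, so \<open>x\<close> would be the partner of both
    \<open>y\<close> and some vertex of \<open>S\<close>.\<close>
  have "h ` S = R `` S"
  proof (rule card_seteq)
    show "card (R `` S) \<le> card (h ` S)"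
      using less \<open>inj_on h A\<close> S(1) by (metis card_image inj_on_subset not_less psubset_imp_subset)
  qed (use S hR finite_image_R in auto)
  then obtain z where "z \<in> S" "h z = x" using fS s' by (metis imageE imageI)
  moreover have "h y = x" using h(2) by simp
  ultimately show False using xy(3) yA S(1) inj_onD[OF \<open>inj_on h A\<close>, of z y] by auto
qed

text \<open>If \<open>v\<close> had at most \<open>k\<close> neighbours, a matching of size \<open>k\<close> could cover all of them while
  missing \<open>v\<close>; such a matching lies in no perfect matching.\<close>

lemma extendable_degree:
  assumes ext: "extendable k (A \<union> B) edges" and k: "k \<ge> 1" and v: "v \<in> A"
  shows "k + 1 \<le> card (R `` {v})"
proof (rule ccontr)
  assume "\<not> ?thesis"
  then have deg: "card (R `` {v}) \<le> k" by simp
  have AB: "card A = card B" and n: "k + 1 \<le> card A"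
    using extendable_sides[OF ext] by blast+
  have N: "R `` {v} \<subseteq> B" using sides by blast
  \<comment> \<open>The side \<open>B\<close> has at least \<open>k + 1\<close> vertices, more than
    the assumed degree of \<open>v\<close>.\<close>
  then obtain z where z: "z \<in> B" "z \<notin> R `` {v}"
    using deg AB n by (metis Suc_eq_plus1 not_less_eq_eq order_trans subsetI subset_antisym)
  have "\<exists>g. saturates (A - {v}) g \<and> g ` (A - {v}) \<subseteq> B - {z}"
  proof (rule hall_into)
    fix S assume S: "S \<subseteq> A - {v}"
    show "card S \<le> card (R `` S \<inter> (B - {z}))"
    proof (cases "S = {}")
      case False
      then have "card S < card (R `` S)" using extendable_expansion[OF ext k] S v by blast
      moreover have "R `` S \<inter> (B - {z}) = R `` S - {z}" using sides by blast
      ultimately show ?thesis using diff_card_le_card_Diff[of "{z}" "R `` S"] by simp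
    qed auto
  qed auto
  then obtain g where g: "saturates (A - {v}) g" "g ` (A - {v}) \<subseteq> B - {z}" by blast
  have injg: "inj_on g (A - {v})" using g by (auto simp: saturates_def)
  have onto: "g ` (A - {v}) = B - {z}"
    by (rule card_seteq) (use g(2) finite_sides injg AB v z in \<open>auto simp: card_image\<close>)
  \<comment> \<open>These are the partners of the neighbours of \<open>v\<close>; none of those
    neighbours is \<open>z\<close>, so \<open>g\<close> reaches them all.\<close>
  define X0 where "X0 = {x \<in> A - {v}. g x \<in> R `` {v}}"
  have "g ` X0 = R `` {v}" using onto N z by (auto simp: X0_def image_iff)
  moreover have "inj_on g X0" using injg by (auto simp: X0_def inj_on_def)
  ultimately have "card X0 \<le> k" using deg by (metis card_image)
  moreover have "X0 \<subseteq> A - {v}" by (auto simp: X0_def)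
  moreover have "k \<le> card (A - {v})" using n v by simp
  \<comment> \<open>Extendability speaks of matchings of size exactly \<open>k\<close>, hence the
    padding of \<open>X0\<close> within \<open>A - {v}\<close>.\<close>
  ultimately obtain X where X: "X0 \<subseteq> X" "X \<subseteq> A - {v}" "card X = k"
    using exists_subset_between[of X0 k "A - {v}"] finite_sides(1) by blast
  have "saturates X g" using g(1) X(2) by (auto simp: saturates_def inj_on_def)
  then obtain h where h: "saturates A h" "\<forall>x\<in>X. h x = g x"
    using extendableD(4)[OF ext] X(3) by blast
  have "h v \<in> R `` {v}" using h(1) v by (auto simp: saturates_def)
  then obtain x where "x \<in> X0" "g x = h v" using \<open>g ` X0 = R `` {v}\<close> by (metis imageE)
  then have "x \<in> X" "h x = h v" using X(1) h(2) by auto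
  then show False using X(2) h(1) v by (auto simp: saturates_def inj_on_def)
qed

text \<open>Each edge is counted once at its endpoint in \<open>A\<close>, and \<open>A\<close>
  holds half of the vertices.\<close>

lemma extendable_card_edges:
  assumes "extendable k (A \<union> B) edges" and "k \<ge> 1"
  shows "card (A \<union> B) * (k + 1) \<le> 2 * card edges"
proof -
  have "R = Sigma A (\<lambda>v. R `` {v})" using sides by auto
  then have "card R = (\<Sum>v\<in>A. card (R `` {v}))"
    using finite_sides finite_image_R by (metis card_SigmaI)
  moreover have "(\<Sum>v\<in>A. k + 1) \<le> (\<Sum>v\<in>A. card (R `` {v}))"
    by (intro sum_mono extendable_degree[OF assms])
  ultimately have "card A * (k + 1) \<le> card R" by simp
  then show ?thesis
    using extendable_sides[OF assms(1)] by (metis card_edges mult.assoc mult_le_mono2)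
qed

end

lemma bipartite_graphE:
  assumes "bipartite_graph V E"
  obtains A B R where "bigraph A B R" "V = A \<union> B" "E = bigraph.edges R"
proof -
  obtain A B where AB: "A \<union> B = V" "A \<inter> B = {}" "\<forall>e\<in>E. \<exists>a\<in>A. \<exists>b\<in>B. e = {a, b}"
    and fin: "finite V"
    using assms unfolding bipartite_graph_def fin_simple_graph_def by auto
  define R where "R = {(a, b). a \<in> A \<and> b \<in> B \<and> {a, b} \<in> E}"
  have bg: "bigraph A B R"
    using AB fin by unfold_locales (auto simp: R_def)
  moreover have "E = bigraph.edges R"
    unfolding bigraph.edges_def[OF bg] using AB(3) by (auto simp: R_def image_iff)
  ultimately show ?thesis using that AB(1) by blast
qed

section \<open>The extremal circulant\<close>

text \<open>The right-hand copy of the residue \<open>m\<close> is encoded as \<open>n + m\<close>,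
  which keeps it apart from the left-hand vertices below \<open>n\<close>.\<close>

definition circulant :: "nat \<Rightarrow> nat \<Rightarrow> (nat \<times> nat) set" where
  "circulant n k = (\<lambda>(i, j). (i, n + (i + j) mod n)) ` ({..<n} \<times> {..k})"

lemma circulant_iff: "(i, b) \<in> circulant n k \<longleftrightarrow> i < n \<and> (\<exists>j\<le>k. b = n + (i + j) mod n)"
  by (auto simp: circulant_def image_iff)

text \<open>For \<open>k < n\<close> the residues of \<open>i\<close>, ..., \<open>i + k\<close> are
  distinct, since two of them differ by less than \<open>n\<close>.\<close>

lemma card_circulant:
  assumes "k < n" shows "card (circulant n k) = n * (k + 1)"
proof -
  have le: "j' \<le> j" if eq: "(i + j) mod n = (i + j') mod n" and "j' \<le> k" for i j j' :: nat
  proof (rule ccontr)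
    assume "\<not> j' \<le> j"
    then have "n dvd j' - j" "0 < j' - j"
      using mod_eq_dvd_iff_nat[of "i + j" "i + j'" n] eq by auto
    then show False using that(2) assms by (auto dest: dvd_imp_le)
  qed
  have "inj_on (\<lambda>(i, j). (i, n + (i + j) mod n)) ({..<n} \<times> {..k})"
  proof (rule inj_onI)
    fix p q assume *: "p \<in> {..<n} \<times> {..k}" "q \<in> {..<n} \<times> {..k}"
      "(case p of (i, j) \<Rightarrow> (i, n + (i + j) mod n)) = (case q of (i, j) \<Rightarrow> (i, n + (i + j) mod n))"
    obtain i j i' j' where "p = (i, j)" "q = (i', j')" by (meson surj_pair)
    then show "p = q"
      using * le[of i j j'] le[of i j' j] by auto
  qed
  then show ?thesis by (simp add: circulant_def card_image)
qed

lemma shift_closed_eq: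
  assumes "T \<subseteq> {..<n}" "T \<noteq> {}" "\<And>x. x \<in> T \<Longrightarrow> Suc x mod n \<in> T"
  shows "T = {..<n::nat}"
proof
  obtain t where t: "t \<in> T" "t < n" using assms by blast
  have *: "(t + m) mod n \<in> T" for m
  proof (induction m)
    case (Suc m)
    then show ?case using assms(3) by (metis add_Suc_right mod_Suc_eq)
  qed (use t in simp)
  show "{..<n} \<subseteq> T"
  proof
    fix x assume "x \<in> {..<n}"
    \<comment> \<open>From \<open>t\<close>, a total of \<open>n - t + x\<close> cyclic shifts lead
      to \<open>n + x\<close>, which is \<open>x\<close> modulo \<open>n\<close>.\<close>
    then show "x \<in> T" using *[of "n - t + x"] t by simp
  qed
qed fact

text \<open>Raising \<open>k\<close> by one adds the cyclic shift of the current neighbourhood. A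
  nonempty proper set of residues is not closed under the shift, so the neighbourhood gains an
  element at each step until it is everything.\<close>

lemma circulant_expansion:
  assumes "S \<subseteq> {..<n}" "S \<noteq> {}"
  shows "min n (card S + k) \<le> card (circulant n k `` S)"
proof -
  define D where "D k = (\<lambda>(i, j). (i + j) mod n) ` (S \<times> {..k})" for k
  have n: "n > 0" using assms by auto
  have fS: "finite S" using assms(1) finite_subset by blast
  have D: "D k \<subseteq> {..<n}" "D k \<noteq> {}" "finite (D k)" for k
    using n assms(2) fS by (auto simp: D_def)
  have D0: "D 0 = S" using assms(1) by (force simp: D_def image_iff)
  have sub: "D k \<subseteq> D (Suc k)" for k by (auto simp: D_def image_iff)
  have shift: "Suc x mod n \<in> D (Suc k)" if "x \<in> D k" for x k
  proof -
    obtain i j where "i \<in> S" "j \<le> k" "x = (i + j) mod n" using \<open>x \<in> D k\<close> by (auto simp: D_def)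
    then have "Suc x mod n = (i + Suc j) mod n" "(i, Suc j) \<in> S \<times> {..Suc k}"
      by (auto simp: mod_Suc_eq)
    then show ?thesis unfolding D_def by (metis (mono_tags, lifting) case_prod_conv image_eqI)
  qed
  have "min n (card S + k) \<le> card (D k)"
  proof (induction k)
    case (Suc k)
    show ?case
    proof (cases "D (Suc k) = D k")
      case True
      then have "D k = {..<n}" using shift_closed_eq[of "D k" n] D shift[of _ k] by simp
      then show ?thesis using True by simp
    next
      case False
      then have "card (D k) < card (D (Suc k))"
        using sub[of k] D(3) by (intro psubset_card_mono) auto
      then show ?thesis using Suc by linarith
    qed
  qed (simp add: D0)
  also have "card (D k) = card ((+) n ` D k)" by (simp add: card_image)
  also have "(+) n ` D k = circulant n k `` S"
    using assms(1) by (force simp: D_def circulant_iff Image_iff image_iff)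
  finally show ?thesis .
qed

lemma bigraph_circulant: "n > 0 \<Longrightarrow> bigraph {..<n} {n..<2 * n} (circulant n k)"
  by unfold_locales (auto simp: circulant_iff)

lemma connected_circulant:
  assumes "n > 0" "k \<ge> 1"
  shows "connected_graph ({..<n} \<union> {n..<2 * n}) (bigraph.edges (circulant n k))"
proof -
  interpret bigraph "{..<n}" "{n..<2 * n}" "circulant n k" using bigraph_circulant assms by blast
  define r where "r = {(x, y). {x, y} \<in> edges}"
  have "sym r" by (auto simp: r_def sym_def insert_commute)
  then have symr: "sym (r\<^sup>*)" by (rule sym_rtrancl)
  have r: "(i, n + (i + j) mod n) \<in> r" "(n + (i + j) mod n, i) \<in> r" if "i < n" "j \<le> k" for i j
  proof -
    show "(i, n + (i + j) mod n) \<in> r"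
      using that edge_iff[of i] by (auto simp: r_def circulant_iff)
    then show "(n + (i + j) mod n, i) \<in> r" using \<open>sym r\<close> by (meson symD)
  qed
  have left: "(0, i) \<in> r\<^sup>*" if "i < n" for i
    using that
  proof (induction i)
    case (Suc i)
    \<comment> \<open>Consecutive left vertices share the right vertex \<open>n + Suc i\<close>,
      reached with offsets 1 and 0; offset 1 is available as \<open>k\<close> is positive.\<close>
    have "(i, n + (i + 1) mod n) \<in> r" "(n + (Suc i + 0) mod n, Suc i) \<in> r"
      using r(1)[of i 1] r(2)[of "Suc i" 0] Suc.prems assms by auto
    then have "(i, Suc i) \<in> r\<^sup>*" by (simp add: converse_rtrancl_into_rtrancl r_into_rtrancl)
    then show ?case using Suc by (meson Suc_lessD rtrancl_trans)
  qed simp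
  have right: "(0, b) \<in> r\<^sup>*" if "b \<in> {n..<2 * n}" for b
  proof -
    have "(b - n, b) \<in> r" using r(1)[of "b - n" 0] that by auto
    moreover have "(0, b - n) \<in> r\<^sup>*" using left that by auto
    ultimately show ?thesis by (meson rtrancl.rtrancl_into_rtrancl)
  qed
  have "(u, v) \<in> r\<^sup>*" if "u \<in> {..<n} \<union> {n..<2 * n}" "v \<in> {..<n} \<union> {n..<2 * n}" for u v
  proof -
    have "(0, u) \<in> r\<^sup>*" "(0, v) \<in> r\<^sup>*" using that left right by blast+
    then show ?thesis using symr by (meson rtrancl_trans symD)
  qed
  then show ?thesis
    unfolding connected_graph_def using fin_simple assms(1) by (auto simp: r_def)
qed

lemma extendable_circulant:
  assumes "k \<ge> 1" "k < n"
  shows "extendable k ({..<n} \<union> {n..<2 * n}) (bigraph.edges (circulant n k))"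
proof -
  have n: "n > 0" using assms by simp
  interpret bigraph "{..<n}" "{n..<2 * n}" "circulant n k" using bigraph_circulant n by blast
  have "saturates {..<k} ((+) n)"
    unfolding saturates_def circulant_iff using assms(2)
    by (auto intro!: exI[of _ 0])
  then have "\<exists>X g. saturates X g \<and> card X = k" by (metis card_lessThan)
  moreover have "card ({..<n} \<union> {n..<2 * n}) = 2 * n" by (subst card_Un_disjoint) auto
  moreover have "\<exists>h. saturates {..<n} h \<and> h ` {..<n} = {n..<2 * n} \<and> (\<forall>x\<in>X. h x = g x)"
    if "saturates X g" "card X = k" for X g
    by (rule saturates_extension[OF _ _ that]) (use circulant_expansion in auto)
  ultimately show ?thesis
    unfolding extendable_iff using connected_circulant[OF n assms(1)] assms by auto
qed

section \<open>The minimum number of edges\<close>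

theorem mainTheorem2:
  fixes k \<nu> :: nat
  assumes "k \<ge> 1" and "even \<nu>" and "\<nu> \<ge> 2 * k + 2"
  shows "(\<exists>(V :: nat set) E. extendable k V E \<and> bipartite_graph V E \<and> card V = \<nu> \<and>
            real (card E) = real \<nu> * (real k + 1) / 2) \<and>
         (\<forall>(V :: 'a set) E. extendable k V E \<and> bipartite_graph V E \<and> card V = \<nu> \<longrightarrow>
            real (card E) \<ge> real \<nu> * (real k + 1) / 2)"
proof (intro conjI allI impI)
  obtain n where n: "\<nu> = 2 * n" using assms(2) by blast
  then have "k < n" using assms(3) by simp
  interpret bigraph "{..<n}" "{n..<2 * n}" "circulant n k"
    using bigraph_circulant \<open>k < n\<close> by simp
  have "card ({..<n} \<union> {n..<2 * n}) = \<nu>" by (subst card_Un_disjoint) (auto simp: n)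
  moreover have "real (card edges) = real \<nu> * (real k + 1) / 2"
    using card_circulant[OF \<open>k < n\<close>] by (simp add: card_edges n algebra_simps)
  ultimately show "\<exists>(V :: nat set) E. extendable k V E \<and> bipartite_graph V E \<and> card V = \<nu> \<and>
            real (card E) = real \<nu> * (real k + 1) / 2"
    using extendable_circulant[OF assms(1) \<open>k < n\<close>] bipartite by blast
next
  fix V :: "'a set" and E
  assume VE: "extendable k V E \<and> bipartite_graph V E \<and> card V = \<nu>"
  then obtain A B R where R: "bigraph A B R" "V = A \<union> B" "E = bigraph.edges R"
    using bipartite_graphE by blast
  have "\<nu> * (k + 1) \<le> 2 * card E"
    using bigraph.extendable_card_edges[OF R(1)] VE assms(1) unfolding R(2,3) by blast
  then have "real (\<nu> * (k + 1)) \<le> real (2 * card E)" by (rule of_nat_mono)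
  then show "real (card E) \<ge> real \<nu> * (real k + 1) / 2" by (simp add: algebra_simps)
qed

end
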